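(* Let $\epsilon\in(0,\frac12)$ and let $n$ be a positive integer such that $$n\ge\Big(\frac{2v+1}{\alpha}\Big)^{\frac{\alpha}{\alpha-1}}\,\frac{2\alpha\log(\epsilon^{-1})}{v}.$$ Let $\beta=\frac12\Big(\frac{2\alpha\log(\epsilon^{-1})}{nv}\Big)^{1/\alpha}$ and let $\hat\theta$ be the estimator of $m$ associated with $\beta$, i.e. the solution of $\sum_{i=1}^n\varphi\big(\beta(X_i-\hat\theta)\big)=0$. Then, with probability at least $1-2\epsilon$, $$|m-\hat\theta|<\frac{2\Big(\frac{2\alpha\log(\epsilon^{-1})}{n}\Big)^{\frac{\alpha-1}{\alpha}}v^{\frac1\alpha}}{\alpha-\Big(\frac{2\alpha\log(\epsilon^{-1})}{nv}\Big)^{\frac{\alpha-1}{\alpha}}},$$ and the right-hand side is $O\Big(\big(\log(\epsilon^{-1})\big)^{\frac{\alpha-1}{\alpha}}n^{-\frac{\alpha-1}{\alpha}}\Big)$, with implied constant depending only on $\alpha$ and $v$.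
   Context: Let $\alpha\in(1,2)$. Let $X_1,\dots,X_n$ be i.i.d. real random variables with $\mathbb{E}|X_1|^\alpha<\infty$; put $m=\mathbb{E}[X_1]$ and $v=\mathbb{E}|X_1-m|^\alpha$, with $v>0$. Let $\varphi:\mathbb{R}\to\mathbb{R}$ be a non-decreasing function satisfying, for all $x\in\mathbb{R}$, $$-\log\Big(1-x+\frac{|x|^\alpha}{\alpha}\Big)\le\varphi(x)\le\log\Big(1+x+\frac{|x|^\alpha}{\alpha}\Big).$$ The estimator $\hat\theta$ is a (real-valued) random variable satisfying the displayed equation in the claim. *)

theory Defs
  imports "HOL-Probability.Probability" "HOL-Library.Landau_Symbols"
begin

definition iid_sample :: "'a measure \<Rightarrow> (nat \<Rightarrow> 'a \<Rightarrow> real) \<Rightarrow> nat \<Rightarrow> bool" where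
  "iid_sample M X n \<longleftrightarrow>
     prob_space M \<and>
     prob_space.indep_vars M (\<lambda>_. borel) X {1..n} \<and>
     (\<forall>i\<in>{1..n}. distr M borel (X i) = distr M borel (X 1))"

definition influence_function :: "real \<Rightarrow> (real \<Rightarrow> real) \<Rightarrow> bool" where
  "influence_function \<alpha> \<phi> \<longleftrightarrow>
     mono \<phi> \<and>
     (\<forall>x. - ln (1 - x + \<bar>x\<bar> powr \<alpha> / \<alpha>) \<le> \<phi> x \<and>
          \<phi> x \<le> ln (1 + x + \<bar>x\<bar> powr \<alpha> / \<alpha>))"

text \<open>The estimating equation is only required almost surely, and \<open>\<theta>\<close> need not be
  its unique solution.\<close>

definition catoni_estimator ::
  "'a measure \<Rightarrow> (nat \<Rightarrow> 'a \<Rightarrow> real) \<Rightarrow> nat \<Rightarrow> (real \<Rightarrow> real) \<Rightarrow> real \<Rightarrow> ('a \<Rightarrow> real) \<Rightarrow> bool" where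
  "catoni_estimator M X n \<phi> \<beta> \<theta> \<longleftrightarrow>
     \<theta> \<in> borel_measurable M \<and>
     (AE \<omega> in M. (\<Sum>i=1..n. \<phi> (\<beta> * (X i \<omega> - \<theta> \<omega>))) = 0)"

definition scale_parameter :: "real \<Rightarrow> real \<Rightarrow> real \<Rightarrow> nat \<Rightarrow> real" where
  "scale_parameter \<alpha> v \<epsilon> n = 1/2 * (2 * \<alpha> * ln (1/\<epsilon>) / (real n * v)) powr (1/\<alpha>)"

text \<open>Big-O over the principal filter of the admissible pairs \<open>(\<epsilon>, n)\<close> is a bound that is uniform in
  all of them, with a constant depending only on \<open>\<alpha>\<close> and \<open>v\<close>.\<close>

definition admissible :: "real \<Rightarrow> real \<Rightarrow> real \<Rightarrow> nat \<Rightarrow> bool" where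
  "admissible \<alpha> v \<epsilon> n \<longleftrightarrow>
     0 < \<epsilon> \<and> \<epsilon> < 1/2 \<and> 0 < n \<and>
     real n \<ge> ((2 * v + 1) / \<alpha>) powr (\<alpha> / (\<alpha> - 1)) * (2 * \<alpha> * ln (1/\<epsilon>) / v)"

definition deviation_bound :: "real \<Rightarrow> real \<Rightarrow> real \<Rightarrow> nat \<Rightarrow> real" where
  "deviation_bound \<alpha> v \<epsilon> n =
     2 * (2 * \<alpha> * ln (1/\<epsilon>) / real n) powr ((\<alpha> - 1) / \<alpha>) * v powr (1/\<alpha>) /
     (\<alpha> - (2 * \<alpha> * ln (1/\<epsilon>) / (real n * v)) powr ((\<alpha> - 1) / \<alpha>))"

end

theory Submission imports Defs begin

text \<open>
  The logarithmic envelope of the influence function makes \<open>exp (\<phi> x)\<close> at most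
  \<open>1 + x + \<bar>x\<bar> powr \<alpha> / \<alpha>\<close>, so the exponential moments of
  \<open>\<Sum>i. \<phi> (\<beta> * (X i - c))\<close> are controlled by the mean and the \<open>\<alpha>\<close>-th moment alone, although
  the \<open>X i\<close> themselves may have no exponential moment and no variance. This Chernoff bound is
  \<open>catoni_chernoff\<close>.

  As \<open>\<phi>\<close> is non-decreasing, the sum is non-increasing in \<open>c\<close>; hence the estimator can only
  reach \<open>m + D\<close> if the sum at \<open>c = m + D\<close> is still non-negative. By the Chernoff
  bound and the convexity inequality \<open>abs_diff_powr_le\<close>, this event has probability at most
  \<open>exp (n * (- \<beta> * D + \<beta> * (s / \<alpha>) * (v + D powr \<alpha>)))\<close>, where \<open>s = (2 * \<beta>) powr (\<alpha> - 1)\<close>.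
  For the given \<open>\<beta>\<close> one has \<open>ln (1/\<epsilon>) = n * \<beta> * (s / \<alpha>) * v\<close>, so the bound is at most \<open>\<epsilon>\<close>
  as soon as \<open>(s / \<alpha>) * (2 * v + D powr \<alpha>) \<le> D\<close>. If \<open>D \<le> 1\<close>, then \<open>D powr \<alpha> \<le> D\<close>, and the
  solution \<open>D = 2 * s * v / (\<alpha> - s)\<close> of the linear equation
  \<open>(s / \<alpha>) * (2 * v + D) = D\<close> suffices: this is the deviation bound. The lower bound on
  the sample size says exactly that \<open>s \<le> \<alpha> / (2 * v + 1)\<close>, which is the same as \<open>D \<le> 1\<close>.

  The other tail is the same statement for the reflected data \<open>- X i\<close> and the
  reflected influence function \<open>\<lambda>x. - \<phi> (- x)\<close>. The order of magnitude
  follows because \<open>s \<le> \<alpha> / (2 * v + 1)\<close> keeps the denominator \<open>\<alpha> - s\<close> away from zero.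
\<close>

section \<open>Inequalities for real powers\<close>

text \<open>Convexity of \<open>\<lambda>y. y powr \<alpha>\<close> at the midpoint of \<open>\<bar>x - m\<bar>\<close> and \<open>\<bar>m - c\<bar>\<close>.\<close>

lemma abs_diff_powr_le:
  fixes x m c \<alpha> :: real
  assumes "1 < \<alpha>"
  shows "\<bar>x - c\<bar> powr \<alpha> \<le> 2 powr (\<alpha> - 1) * (\<bar>x - m\<bar> powr \<alpha> + \<bar>m - c\<bar> powr \<alpha>)"
proof -
  have one_le: "(1::real) \<le> 2 powr (\<alpha> - 1)"
    using assms by (intro ge_one_powr_ge_zero) auto
  have key: "(a + b) powr \<alpha> \<le> 2 powr (\<alpha> - 1) * (a powr \<alpha> + b powr \<alpha>)"
    if "0 \<le> a" "0 \<le> b" for a b :: real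
  proof (cases "a = 0 \<or> b = 0")
    case True
    have "1 * (a + b) powr \<alpha> \<le> 2 powr (\<alpha> - 1) * (a + b) powr \<alpha>"
      by (intro mult_right_mono one_le) auto
    with True show ?thesis by auto
  next
    case False
    with that have pos: "0 < a" "0 < b" by auto
    have "((1/2) * a + (1/2) * b) powr \<alpha> \<le> (1/2) * a powr \<alpha> + (1/2) * b powr \<alpha>"
      using convex_onD[OF powr_convex[of \<alpha>], of "1/2" a b] assms pos by simp
    then have mid: "((1/2) * (a + b)) powr \<alpha> \<le> (1/2) * (a powr \<alpha> + b powr \<alpha>)"
      by (simp only: distrib_left)
    have "(a + b) powr \<alpha> = (2 * ((1/2) * (a + b))) powr \<alpha>"
      by (simp only: mult.assoc[symmetric]) simp
    also have "\<dots> = 2 powr \<alpha> * ((1/2) * (a + b)) powr \<alpha>"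
      by (rule powr_mult)
    also have "\<dots> \<le> 2 powr \<alpha> * ((1/2) * (a powr \<alpha> + b powr \<alpha>))"
      using mid by (rule mult_left_mono) simp
    also have "\<dots> = 2 powr (\<alpha> - 1) * (a powr \<alpha> + b powr \<alpha>)"
      by (simp add: powr_diff)
    finally show ?thesis .
  qed
  have "\<bar>x - c\<bar> powr \<alpha> \<le> (\<bar>x - m\<bar> + \<bar>m - c\<bar>) powr \<alpha>"
    using assms by (intro powr_mono2) auto
  also have "\<dots> \<le> 2 powr (\<alpha> - 1) * (\<bar>x - m\<bar> powr \<alpha> + \<bar>m - c\<bar> powr \<alpha>)"
    by (intro key) auto
  finally show ?thesis .
qed

text \<open>Young's inequality against the constant \<open>1\<close>. It makes the arguments of both logarithms in the
  definition of an influence function positive.\<close>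

lemma abs_less_one_plus_powr:
  fixes x \<alpha> :: real
  assumes "1 < \<alpha>"
  shows "\<bar>x\<bar> < 1 + \<bar>x\<bar> powr \<alpha> / \<alpha>"
proof -
  have "\<bar>x\<bar> * 1 \<le> \<bar>x\<bar> powr \<alpha> / \<alpha> + 1 powr (\<alpha> / (\<alpha> - 1)) / (\<alpha> / (\<alpha> - 1))"
    using assms by (intro Youngs_inequality) (auto simp: field_simps)
  moreover have "(\<alpha> - 1) / \<alpha> < 1"
    using assms by simp
  ultimately show ?thesis by simp
qed

section \<open>The one-sided deviation inequality\<close>

lemma
  assumes "iid_sample M X n"
  shows iid_sample_prob_space: "prob_space M"
    and iid_sample_indep: "prob_space.indep_vars M (\<lambda>_. borel) X {1..n}"
    and iid_sample_distr: "i \<in> {1..n} \<Longrightarrow> distr M borel (X i) = distr M borel (X 1)"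
    and iid_sample_measurable: "i \<in> {1..n} \<Longrightarrow> X i \<in> borel_measurable M"
proof -
  show "prob_space M" and "prob_space.indep_vars M (\<lambda>_. borel) X {1..n}"
    and "i \<in> {1..n} \<Longrightarrow> distr M borel (X i) = distr M borel (X 1)"
    using assms unfolding iid_sample_def by blast+
  then show "i \<in> {1..n} \<Longrightarrow> X i \<in> borel_measurable M"
    by (simp add: prob_space.indep_vars_def2)
qed

text \<open>Markov's inequality for \<open>exp (\<Sum>i. \<phi> (\<beta> * (X i - c)))\<close>, whose expectation factorises by
  independence; each factor is at most \<open>1 + y \<le> exp y\<close>, with \<open>y\<close> the expected value of the
  non-constant part of the envelope.\<close>

lemma (in prob_space) catoni_chernoff:
  fixes X :: "nat \<Rightarrow> 'a \<Rightarrow> real" and \<phi> :: "real \<Rightarrow> real"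
  assumes iid: "iid_sample M X n"
    and int: "integrable M (X 1)" "integrable M (\<lambda>\<omega>. \<bar>X 1 \<omega> - c\<bar> powr \<alpha>)"
    and "1 < \<alpha>" and "0 < \<beta>" and "mono \<phi>"
    and envelope: "\<And>x. \<phi> x \<le> ln (1 + x + \<bar>x\<bar> powr \<alpha> / \<alpha>)"
  shows "prob {\<omega> \<in> space M. 0 \<le> (\<Sum>i=1..n. \<phi> (\<beta> * (X i \<omega> - c)))}
    \<le> exp (real n * (\<beta> * (expectation (X 1) - c)
        + \<beta> powr \<alpha> / \<alpha> * expectation (\<lambda>\<omega>. \<bar>X 1 \<omega> - c\<bar> powr \<alpha>)))"
proof -
  note indep = iid_sample_indep[OF iid] and distr_eq = iid_sample_distr[OF iid]
    and rv = iid_sample_measurable[OF iid]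
  have X1: "X 1 \<in> borel_measurable M"
    using int(1) by auto
  define g where "g = (\<lambda>x. exp (\<phi> (\<beta> * (x - c))))"
  define y where "y = \<beta> * (expectation (X 1) - c)
        + \<beta> powr \<alpha> / \<alpha> * expectation (\<lambda>\<omega>. \<bar>X 1 \<omega> - c\<bar> powr \<alpha>)"
  have [measurable]: "\<phi> \<in> borel_measurable borel"
    using \<open>mono \<phi>\<close> by (rule borel_measurable_mono)
  have g[measurable]: "g \<in> borel_measurable borel"
    unfolding g_def by measurable
  have g_le: "g x \<le> 1 + \<beta> * (x - c) + \<beta> powr \<alpha> / \<alpha> * \<bar>x - c\<bar> powr \<alpha>" for x
  proof -
    let ?z = "\<beta> * (x - c)"
    have "0 < 1 + ?z + \<bar>?z\<bar> powr \<alpha> / \<alpha>"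
      using abs_less_one_plus_powr[OF \<open>1 < \<alpha>\<close>, of ?z] by linarith
    moreover have "g x \<le> exp (ln (1 + ?z + \<bar>?z\<bar> powr \<alpha> / \<alpha>))"
      unfolding g_def using envelope by simp
    ultimately have "g x \<le> 1 + ?z + \<bar>?z\<bar> powr \<alpha> / \<alpha>"
      by simp
    then show ?thesis
      using \<open>0 < \<beta>\<close> by (simp add: abs_mult powr_mult)
  qed
  have int_bound: "integrable M (\<lambda>\<omega>. 1 + \<beta> * (X 1 \<omega> - c) + \<beta> powr \<alpha> / \<alpha> * \<bar>X 1 \<omega> - c\<bar> powr \<alpha>)"
    using int by auto
  have int_g1: "integrable M (\<lambda>\<omega>. g (X 1 \<omega>))"
  proof (rule Bochner_Integration.integrable_bound[OF int_bound])
    show "(\<lambda>\<omega>. g (X 1 \<omega>)) \<in> borel_measurable M"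
      using X1 g by measurable
    show "AE \<omega> in M. norm (g (X 1 \<omega>))
        \<le> norm (1 + \<beta> * (X 1 \<omega> - c) + \<beta> powr \<alpha> / \<alpha> * \<bar>X 1 \<omega> - c\<bar> powr \<alpha>)"
    proof (rule AE_I2)
      fix \<omega>
      have "0 < g (X 1 \<omega>)" by (simp add: g_def)
      then show "norm (g (X 1 \<omega>))
          \<le> norm (1 + \<beta> * (X 1 \<omega> - c) + \<beta> powr \<alpha> / \<alpha> * \<bar>X 1 \<omega> - c\<bar> powr \<alpha>)"
        using g_le[of "X 1 \<omega>"] by simp
    qed
  qed
  have "expectation (\<lambda>\<omega>. g (X 1 \<omega>))
      \<le> expectation (\<lambda>\<omega>. 1 + \<beta> * (X 1 \<omega> - c) + \<beta> powr \<alpha> / \<alpha> * \<bar>X 1 \<omega> - c\<bar> powr \<alpha>)"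
    by (intro integral_mono int_g1 int_bound g_le)
  also have "\<dots> = 1 + y"
    using int by (simp add: y_def prob_space)
  also have "\<dots> \<le> exp y"
    by (rule exp_ge_add_one_self)
  finally have E1: "expectation (\<lambda>\<omega>. g (X 1 \<omega>)) \<le> exp y" .
  have int_g: "integrable M (\<lambda>\<omega>. g (X i \<omega>))"
    and E_g: "expectation (\<lambda>\<omega>. g (X i \<omega>)) = expectation (\<lambda>\<omega>. g (X 1 \<omega>))"
    if i: "i \<in> {1..n}" for i
  proof -
    have "integrable (distr M borel (X 1)) g"
      using int_g1 X1 by (simp add: integrable_distr_eq)
    then have "integrable (distr M borel (X i)) g"
      by (simp add: distr_eq[OF i])
    then show "integrable M (\<lambda>\<omega>. g (X i \<omega>))"
      using rv[OF i] by (simp add: integrable_distr_eq)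
    have "expectation (\<lambda>\<omega>. g (X i \<omega>)) = integral\<^sup>L (distr M borel (X i)) g"
      using rv[OF i] by (simp add: integral_distr)
    also have "\<dots> = expectation (\<lambda>\<omega>. g (X 1 \<omega>))"
      using X1 by (simp add: distr_eq[OF i] integral_distr)
    finally show "expectation (\<lambda>\<omega>. g (X i \<omega>)) = expectation (\<lambda>\<omega>. g (X 1 \<omega>))" .
  qed
  have indep_g: "indep_vars (\<lambda>_. borel) (\<lambda>i \<omega>. g (X i \<omega>)) {1..n}"
    by (rule indep_vars_compose2[OF indep]) auto
  have int_prod: "integrable M (\<lambda>\<omega>. \<Prod>i\<in>{1..n}. g (X i \<omega>))"
    by (rule indep_vars_integrable[OF _ indep_g]) (auto intro: int_g)
  have exp_sum: "exp (\<Sum>i=1..n. \<phi> (\<beta> * (X i \<omega> - c))) = (\<Prod>i\<in>{1..n}. g (X i \<omega>))" for \<omega>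
    by (simp add: g_def exp_sum)
  have "{\<omega> \<in> space M. 0 \<le> (\<Sum>i=1..n. \<phi> (\<beta> * (X i \<omega> - c)))}
      = {\<omega> \<in> space M. 1 \<le> (\<Prod>i\<in>{1..n}. g (X i \<omega>))}"
    by (simp only: exp_sum[symmetric] one_le_exp_iff)
  also have "prob \<dots> \<le> expectation (\<lambda>\<omega>. \<Prod>i\<in>{1..n}. g (X i \<omega>)) / 1"
    by (rule integral_Markov_inequality_measure[OF int_prod sets.empty_sets])
       (auto simp: g_def intro!: prod_nonneg)
  also have "\<dots> = (\<Prod>i\<in>{1..n}. expectation (\<lambda>\<omega>. g (X i \<omega>)))"
    using indep_vars_lebesgue_integral[OF _ indep_g] int_g by simp
  also have "\<dots> = (\<Prod>i\<in>{1..n}. expectation (\<lambda>\<omega>. g (X 1 \<omega>)))"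
    by (rule prod.cong[OF refl E_g])
  also have "\<dots> = expectation (\<lambda>\<omega>. g (X 1 \<omega>)) ^ n"
    by simp
  also have "\<dots> \<le> exp y ^ n"
    using E1 by (intro power_mono) (auto simp: g_def intro!: Bochner_Integration.integral_nonneg)
  also have "\<dots> = exp (real n * y)"
    by (simp add: exp_of_nat_mult)
  finally show ?thesis
    by (simp add: y_def)
qed

text \<open>Monotonicity of \<open>\<phi>\<close> turns the Chernoff bound at \<open>c = m + D\<close> into a tail bound for any root
  \<open>\<theta>\<close> of the estimating equation. The hypotheses on \<open>\<phi>\<close> are one-sided so that they also hold for
  the reflected influence function.\<close>

lemma (in prob_space) catoni_upper_tail:
  fixes X :: "nat \<Rightarrow> 'a \<Rightarrow> real" and \<phi> :: "real \<Rightarrow> real"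
  assumes iid: "iid_sample M X n"
    and int: "integrable M (X 1)" "\<And>c. integrable M (\<lambda>\<omega>. \<bar>X 1 \<omega> - c\<bar> powr \<alpha>)"
    and m: "m = expectation (X 1)"
    and v: "v = expectation (\<lambda>\<omega>. \<bar>X 1 \<omega> - m\<bar> powr \<alpha>)"
    and "1 < \<alpha>" and "0 < \<beta>" and "0 \<le> D" and "mono \<phi>"
    and envelope: "\<And>x. \<phi> x \<le> ln (1 + x + \<bar>x\<bar> powr \<alpha> / \<alpha>)"
    and root: "AE \<omega> in M. (\<Sum>i=1..n. \<phi> (\<beta> * (X i \<omega> - \<theta> \<omega>))) = 0"
  shows "prob {\<omega> \<in> space M. m + D \<le> \<theta> \<omega>}
    \<le> exp (real n * (- \<beta> * D + \<beta> powr \<alpha> / \<alpha> * (2 powr (\<alpha> - 1) * (v + D powr \<alpha>))))"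
proof -
  note rv = iid_sample_measurable[OF iid]
  have [measurable]: "\<phi> \<in> borel_measurable borel"
    using \<open>mono \<phi>\<close> by (rule borel_measurable_mono)
  have "(\<lambda>\<omega>. \<Sum>i=1..n. \<phi> (\<beta> * (X i \<omega> - (m + D)))) \<in> borel_measurable M"
  proof (rule borel_measurable_sum)
    fix i assume "i \<in> {1..n}"
    note [measurable] = rv[OF this]
    show "(\<lambda>\<omega>. \<phi> (\<beta> * (X i \<omega> - (m + D)))) \<in> borel_measurable M" by measurable
  qed
  then have sets: "{\<omega> \<in> space M. 0 \<le> (\<Sum>i=1..n. \<phi> (\<beta> * (X i \<omega> - (m + D))))} \<in> sets M"
    by measurable
  have "AE \<omega> in M. \<omega> \<in> {\<omega> \<in> space M. m + D \<le> \<theta> \<omega>} \<longrightarrow>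
      \<omega> \<in> {\<omega> \<in> space M. 0 \<le> (\<Sum>i=1..n. \<phi> (\<beta> * (X i \<omega> - (m + D))))}"
    using root
  proof eventually_elim
    case (elim \<omega>)
    have "(\<Sum>i=1..n. \<phi> (\<beta> * (X i \<omega> - \<theta> \<omega>))) \<le> (\<Sum>i=1..n. \<phi> (\<beta> * (X i \<omega> - (m + D))))"
      if "m + D \<le> \<theta> \<omega>"
      using that \<open>0 < \<beta>\<close> by (intro sum_mono monoD[OF \<open>mono \<phi>\<close>] mult_left_mono) auto
    with elim show ?case by auto
  qed
  then have "prob {\<omega> \<in> space M. m + D \<le> \<theta> \<omega>}
      \<le> prob {\<omega> \<in> space M. 0 \<le> (\<Sum>i=1..n. \<phi> (\<beta> * (X i \<omega> - (m + D))))}"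
    using sets by (rule finite_measure_mono_AE)
  also have "\<dots> \<le> exp (real n * (\<beta> * (expectation (X 1) - (m + D))
        + \<beta> powr \<alpha> / \<alpha> * expectation (\<lambda>\<omega>. \<bar>X 1 \<omega> - (m + D)\<bar> powr \<alpha>)))"
    by (intro catoni_chernoff assms)
  also have "\<dots> \<le> exp (real n * (- \<beta> * D + \<beta> powr \<alpha> / \<alpha> * (2 powr (\<alpha> - 1) * (v + D powr \<alpha>))))"
  proof -
    have "expectation (\<lambda>\<omega>. \<bar>X 1 \<omega> - (m + D)\<bar> powr \<alpha>)
        \<le> expectation (\<lambda>\<omega>. 2 powr (\<alpha> - 1) * (\<bar>X 1 \<omega> - m\<bar> powr \<alpha> + \<bar>m - (m + D)\<bar> powr \<alpha>))"
      by (intro integral_mono abs_diff_powr_le int \<open>1 < \<alpha>\<close> integrable_mult_right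
          Bochner_Integration.integrable_add integrable_const)
    also have "\<dots> = 2 powr (\<alpha> - 1) * (v + D powr \<alpha>)"
      using int \<open>0 \<le> D\<close> by (simp add: v prob_space)
    finally have "\<beta> powr \<alpha> / \<alpha> * expectation (\<lambda>\<omega>. \<bar>X 1 \<omega> - (m + D)\<bar> powr \<alpha>)
        \<le> \<beta> powr \<alpha> / \<alpha> * (2 powr (\<alpha> - 1) * (v + D powr \<alpha>))"
      using \<open>1 < \<alpha>\<close> by (intro mult_left_mono) auto
    moreover have "\<beta> * (expectation (X 1) - (m + D)) = - \<beta> * D"
      by (simp add: m algebra_simps)
    ultimately show ?thesis
      by (auto intro!: mult_left_mono)
  qed
  finally show ?thesis .
qed

section \<open>The scale parameter and the deviation bound\<close>

text \<open>The sample-size condition solved for \<open>s = (2 * \<beta>) powr (\<alpha> - 1)\<close>.\<close>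

lemma admissible_imp_small:
  fixes \<alpha> v \<epsilon> :: real and n :: nat
  defines "s \<equiv> (2 * \<alpha> * ln (1/\<epsilon>) / (real n * v)) powr ((\<alpha> - 1) / \<alpha>)"
  assumes "1 < \<alpha>" and "0 < v" and adm: "admissible \<alpha> v \<epsilon> n"
  shows "0 < ln (1/\<epsilon>)" and "0 < n" and "0 < s" and "s * (2 * v + 1) \<le> \<alpha>"
proof -
  have \<epsilon>: "0 < \<epsilon>" "\<epsilon> < 1/2"
    using adm unfolding admissible_def by blast+
  show L: "0 < ln (1/\<epsilon>)"
    using \<epsilon> by (intro ln_gt_zero) (simp add: field_simps)
  show n: "0 < n"
    using adm unfolding admissible_def by blast
  define u where "u = 2 * \<alpha> * ln (1/\<epsilon>) / (real n * v)"
  define w where "w = (2 * v + 1) / \<alpha>"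
  have u: "0 < u"
    using L n \<open>1 < \<alpha>\<close> \<open>0 < v\<close> unfolding u_def
    by (intro divide_pos_pos mult_pos_pos) auto
  then show "0 < s"
    by (simp add: s_def flip: u_def)
  have w: "0 < w"
    using \<open>1 < \<alpha>\<close> \<open>0 < v\<close> by (simp add: w_def)
  have "w powr (\<alpha> / (\<alpha> - 1)) * (2 * \<alpha> * ln (1/\<epsilon>) / v) \<le> real n"
    using adm unfolding admissible_def w_def by blast
  moreover have "w powr (\<alpha> / (\<alpha> - 1)) * u
      = w powr (\<alpha> / (\<alpha> - 1)) * (2 * \<alpha> * ln (1/\<epsilon>) / v) / real n"
    by (simp add: u_def mult.commute)
  ultimately have "w powr (\<alpha> / (\<alpha> - 1)) * u \<le> 1"
    using n by (simp only: divide_le_eq_1) simp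
  then have "(w powr (\<alpha> / (\<alpha> - 1)) * u) powr ((\<alpha> - 1) / \<alpha>) \<le> 1"
    using \<open>1 < \<alpha>\<close> u w by (intro powr_le1) auto
  then have "w * s \<le> 1"
    using \<open>1 < \<alpha>\<close> u w by (simp add: powr_mult powr_powr s_def flip: u_def)
  then show "s * (2 * v + 1) \<le> \<alpha>"
    using \<open>1 < \<alpha>\<close> by (simp add: w_def field_simps)
qed

lemma deviation_bound_eq:
  fixes \<alpha> v \<epsilon> :: real and n :: nat
  defines "s \<equiv> (2 * \<alpha> * ln (1/\<epsilon>) / (real n * v)) powr ((\<alpha> - 1) / \<alpha>)"
  assumes "1 < \<alpha>" and "0 < v" and adm: "admissible \<alpha> v \<epsilon> n"
  shows "deviation_bound \<alpha> v \<epsilon> n = 2 * s * v / (\<alpha> - s)"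
proof -
  note L = admissible_imp_small(1,2)[OF \<open>1 < \<alpha>\<close> \<open>0 < v\<close> adm]
  define u where "u = 2 * \<alpha> * ln (1/\<epsilon>) / (real n * v)"
  have "0 \<le> u"
    using L \<open>1 < \<alpha>\<close> \<open>0 < v\<close> by (simp add: u_def)
  moreover have "2 * \<alpha> * ln (1/\<epsilon>) / real n = u * v"
    using \<open>0 < v\<close> by (simp add: u_def)
  ultimately have "(2 * \<alpha> * ln (1/\<epsilon>) / real n) powr ((\<alpha> - 1) / \<alpha>)
      = s * v powr ((\<alpha> - 1) / \<alpha>)"
    using \<open>0 < v\<close> by (simp add: s_def powr_mult flip: u_def)
  moreover have "v powr ((\<alpha> - 1) / \<alpha>) * v powr (1 / \<alpha>) = v"
    using \<open>1 < \<alpha>\<close> \<open>0 < v\<close> by (simp flip: powr_add add_divide_distrib)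
  ultimately show ?thesis
    by (simp add: deviation_bound_def s_def mult.assoc)
qed

text \<open>The exponent of the tail bound at \<open>D\<close>, the deviation bound, is at most \<open>- ln (1/\<epsilon>)\<close>; the
  sample-size condition enters through \<open>D \<le> 1\<close>, which gives \<open>D powr \<alpha> \<le> D\<close>.\<close>

lemma deviation_bound_exponent:
  fixes \<alpha> v \<epsilon> :: real and n :: nat
  defines "\<beta> \<equiv> scale_parameter \<alpha> v \<epsilon> n" and "D \<equiv> deviation_bound \<alpha> v \<epsilon> n"
  assumes "1 < \<alpha>" and "0 < v" and adm: "admissible \<alpha> v \<epsilon> n"
  shows "0 < \<beta>" and "0 < D"
    and "real n * (- \<beta> * D + \<beta> powr \<alpha> / \<alpha> * (2 powr (\<alpha> - 1) * (v + D powr \<alpha>)))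
      \<le> - ln (1/\<epsilon>)"
proof -
  define s where "s = (2 * \<alpha> * ln (1/\<epsilon>) / (real n * v)) powr ((\<alpha> - 1) / \<alpha>)"
  define u where "u = 2 * \<alpha> * ln (1/\<epsilon>) / (real n * v)"
  note small = admissible_imp_small[OF \<open>1 < \<alpha>\<close> \<open>0 < v\<close> adm, folded s_def]
  have u: "0 < u"
    using small(1,2) \<open>1 < \<alpha>\<close> \<open>0 < v\<close> unfolding u_def
    by (intro divide_pos_pos mult_pos_pos) auto
  have \<beta>_eq: "\<beta> = 1/2 * u powr (1/\<alpha>)"
    by (simp add: \<beta>_def scale_parameter_def u_def)
  moreover have "0 < u powr (1/\<alpha>)"
    using u by simp
  ultimately show \<beta>: "0 < \<beta>"
    by linarith
  have "0 < s * v"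
    using small \<open>0 < v\<close> by simp
  moreover have "s * (2 * v + 1) = 2 * (s * v) + s"
    by (simp add: algebra_simps)
  ultimately have s_less: "s < \<alpha>"
    using small by linarith
  have D_eq: "D = 2 * s * v / (\<alpha> - s)"
    unfolding D_def s_def by (rule deviation_bound_eq[OF \<open>1 < \<alpha>\<close> \<open>0 < v\<close> adm])
  show D: "0 < D"
    using small s_less \<open>0 < v\<close> by (simp add: D_eq)
  have "D \<le> 1"
    using small s_less by (simp add: D_eq field_simps)
  then have "D powr \<alpha> \<le> D powr 1"
    using D \<open>1 < \<alpha>\<close> by (intro powr_mono') auto
  then have D_powr: "D powr \<alpha> \<le> D"
    using D by simp
  have s_eq: "s = u powr ((\<alpha> - 1) / \<alpha>)"
    by (simp add: s_def u_def)
  have two_\<beta>: "u powr (1/\<alpha>) = 2 * \<beta>"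
    by (simp add: \<beta>_eq)
  have s_\<beta>: "s = (2 * \<beta>) powr (\<alpha> - 1)"
    by (simp add: s_eq powr_powr flip: two_\<beta>)
  have "u = u powr (1/\<alpha>) * s"
    using u \<open>1 < \<alpha>\<close> by (simp add: s_eq flip: powr_add add_divide_distrib)
  then have "u = 2 * \<beta> * s"
    by (simp add: two_\<beta>)
  \<comment> \<open>\<open>\<beta>\<close> is chosen so that \<open>ln (1/\<epsilon>)\<close> equals the contribution of \<open>v\<close> to the exponent.\<close>
  then have L: "\<alpha> * ln (1/\<epsilon>) = real n * \<beta> * s * v"
    using small \<open>0 < v\<close> by (simp add: u_def field_simps)
  have scale: "\<beta> powr \<alpha> * 2 powr (\<alpha> - 1) = \<beta> * s"
  proof -
    have "\<beta> powr \<alpha> = \<beta> * \<beta> powr (\<alpha> - 1)"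
      using \<beta> by (simp add: powr_mult_base)
    then show ?thesis
      using \<beta> by (simp add: s_\<beta> powr_mult)
  qed
  have "(\<alpha> - s) * D = 2 * s * v"
    using s_less by (simp add: D_eq)
  then have "- \<alpha> * D + s * (v + D) = - s * v"
    by (simp add: algebra_simps)
  moreover have "s * (v + D powr \<alpha>) \<le> s * (v + D)"
    using small D_powr by (intro mult_left_mono) auto
  ultimately have "- \<alpha> * D + s * (v + D powr \<alpha>) \<le> - s * v"
    by linarith
  then have "real n * \<beta> * (- \<alpha> * D + s * (v + D powr \<alpha>)) \<le> real n * \<beta> * (- s * v)"
    using \<beta> by (intro mult_left_mono) auto
  also have "\<dots> = - (\<alpha> * ln (1/\<epsilon>))"
    by (simp add: L)
  finally have main: "real n * \<beta> * (- \<alpha> * D + s * (v + D powr \<alpha>)) / \<alpha> \<le> - ln (1/\<epsilon>)"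
    using \<open>1 < \<alpha>\<close> by (simp add: pos_divide_le_eq mult.commute)
  have "\<beta> powr \<alpha> / \<alpha> * (2 powr (\<alpha> - 1) * (v + D powr \<alpha>))
      = \<beta> * s * (v + D powr \<alpha>) / \<alpha>"
    by (simp flip: scale)
  then have "real n * (- \<beta> * D + \<beta> powr \<alpha> / \<alpha> * (2 powr (\<alpha> - 1) * (v + D powr \<alpha>)))
      = real n * \<beta> * (- \<alpha> * D + s * (v + D powr \<alpha>)) / \<alpha>"
    using \<open>1 < \<alpha>\<close> by (simp add: field_simps)
  with main show "real n * (- \<beta> * D + \<beta> powr \<alpha> / \<alpha> * (2 powr (\<alpha> - 1) * (v + D powr \<alpha>)))
      \<le> - ln (1/\<epsilon>)"
    by simp
qed

text \<open>The sample-size condition gives \<open>\<alpha> - s \<ge> 2 * v * s\<close>, but a denominator bounded below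
  independently of \<open>s\<close> iseeded; replacing \<open>s\<close> by its largest value \<open>\<alpha> / (2 * v + 1)\<close> yields
  \<open>D \<le> s * (2 * v + 1) / \<alpha>\<close>.\<close>

lemma deviation_bound_le:
  fixes \<alpha> v \<epsilon> :: real
  assumes "1 < \<alpha>" and "0 < v" and adm: "admissible \<alpha> v \<epsilon> n"
  shows "deviation_bound \<alpha> v \<epsilon> n
    \<le> (2 * v + 1) / \<alpha> * (2 * \<alpha> / v) powr ((\<alpha> - 1) / \<alpha>)
      * (ln (1/\<epsilon>) powr ((\<alpha> - 1) / \<alpha>) * real n powr (- (\<alpha> - 1) / \<alpha>))"
proof -
  define s where "s = (2 * \<alpha> * ln (1/\<epsilon>) / (real n * v)) powr ((\<alpha> - 1) / \<alpha>)"
  note small = admissible_imp_small[OF \<open>1 < \<alpha>\<close> \<open>0 < v\<close> adm, folded s_def]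
  have denom: "2 * v * \<alpha> / (2 * v + 1) \<le> \<alpha> - s"
    using small \<open>0 < v\<close> by (simp add: field_simps)
  have "0 < 2 * v * \<alpha> / (2 * v + 1)"
    using assms by simp
  then have "2 * s * v / (\<alpha> - s) \<le> 2 * s * v / (2 * v * \<alpha> / (2 * v + 1))"
    using small denom \<open>0 < v\<close> by (intro divide_left_mono mult_pos_pos) auto
  also have "\<dots> = (2 * v + 1) / \<alpha> * s"
    using assms by (simp add: field_simps)
  finally have "2 * s * v / (\<alpha> - s) \<le> (2 * v + 1) / \<alpha> * s" .
  moreover have "s = (2 * \<alpha> / v) powr ((\<alpha> - 1) / \<alpha>)
      * (ln (1/\<epsilon>) powr ((\<alpha> - 1) / \<alpha>) * real n powr (- (\<alpha> - 1) / \<alpha>))"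
  proof -
    have "2 * \<alpha> * ln (1/\<epsilon>) / (real n * v) = (2 * \<alpha> / v) * (ln (1/\<epsilon>) * (1 / real n))"
      by simp
    moreover have "(1 / real n) powr ((\<alpha> - 1) / \<alpha>) = real n powr (- (\<alpha> - 1) / \<alpha>)"
      by (simp add: powr_divide powr_minus_divide[symmetric] minus_divide_left[symmetric]
          del: minus_diff_eq)
    ultimately show ?thesis
      using small assms by (simp only: s_def powr_mult)
  qed
  ultimately show ?thesis
    unfolding deviation_bound_eq[OF assms, folded s_def] by (simp only: mult.assoc)
qed

section \<open>The two-sided deviation inequality\<close>

lemma iid_sample_uminus:
  assumes iid: "iid_sample M X n" and "0 < n"
  shows "iid_sample M (\<lambda>i \<omega>. - X i \<omega>) n"
proof -
  interpret prob_space M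
    using iid by (rule iid_sample_prob_space)
  have push: "distr M borel (\<lambda>\<omega>. - X i \<omega>) = distr (distr M borel (X i)) borel uminus"
    if "i \<in> {1..n}" for i
    using iid_sample_measurable[OF iid that] by (simp add: distr_distr comp_def)
  have "distr M borel (\<lambda>\<omega>. - X i \<omega>) = distr M borel (\<lambda>\<omega>. - X 1 \<omega>)" if i: "i \<in> {1..n}" for i
  proof -
    have "1 \<in> {1..n}"
      using \<open>0 < n\<close> by simp
    then show ?thesis
      by (simp only: push[OF i] push[of 1] iid_sample_distr[OF iid i])
  qed
  moreover have "indep_vars (\<lambda>_. borel) (\<lambda>i \<omega>. - X i \<omega>) {1..n}"
    by (rule indep_vars_compose2[OF iid_sample_indep[OF iid]]) auto
  ultimately show ?thesis
    using prob_space_axioms unfolding iid_sample_def by blast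
qed

text \<open>A union bound over the two tails at distance \<open>D\<close>. Reflection of the data exchanges the two halves
  of the envelope: the upper envelope of \<open>\<lambda>x. - \<phi> (- x)\<close> is the lower envelope of \<open>\<phi>\<close>.\<close>

lemma catoni_deviation:
  fixes X :: "nat \<Rightarrow> 'a \<Rightarrow> real" and \<phi> :: "real \<Rightarrow> real"
  assumes "1 < \<alpha>" and "0 < v" and iid: "iid_sample M X n"
    and moment: "integrable M (\<lambda>\<omega>. \<bar>X 1 \<omega>\<bar> powr \<alpha>)"
    and m: "m = (\<integral>\<omega>. X 1 \<omega> \<partial>M)"
    and v: "v = (\<integral>\<omega>. \<bar>X 1 \<omega> - m\<bar> powr \<alpha> \<partial>M)"
    and infl: "influence_function \<alpha> \<phi>"
    and adm: "admissible \<alpha> v \<epsilon> n"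
    and est: "catoni_estimator M X n \<phi> (scale_parameter \<alpha> v \<epsilon> n) \<theta>"
  shows "1 - 2 * \<epsilon> \<le> measure M {\<omega> \<in> space M. \<bar>m - \<theta> \<omega>\<bar> < deviation_bound \<alpha> v \<epsilon> n}"
proof -
  interpret prob_space M
    using iid by (rule iid_sample_prob_space)
  define \<beta> where "\<beta> = scale_parameter \<alpha> v \<epsilon> n"
  define D where "D = deviation_bound \<alpha> v \<epsilon> n"
  note exponent = deviation_bound_exponent[OF \<open>1 < \<alpha>\<close> \<open>0 < v\<close> adm, folded \<beta>_def D_def]
  have n: "0 < n" and \<epsilon>: "0 < \<epsilon>"
    using adm by (auto simp: admissible_def)
  have X1[measurable]: "X 1 \<in> borel_measurable M"
    by (rule iid_sample_measurable[OF iid]) (use n in simp)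
  have \<theta>[measurable]: "\<theta> \<in> borel_measurable M"
    and root: "AE \<omega> in M. (\<Sum>i=1..n. \<phi> (\<beta> * (X i \<omega> - \<theta> \<omega>))) = 0"
    using est by (auto simp: catoni_estimator_def \<beta>_def)
  have "mono \<phi>" and upper: "\<And>x. \<phi> x \<le> ln (1 + x + \<bar>x\<bar> powr \<alpha> / \<alpha>)"
    and lower: "\<And>x. - ln (1 - x + \<bar>x\<bar> powr \<alpha> / \<alpha>) \<le> \<phi> x"
    using infl by (auto simp: influence_function_def)

  \<comment> \<open>Both moments that enter the Chernoff bound are dominated by the one assumed to be finite.\<close>
  have int_X1: "integrable M (X 1)"
  proof (rule Bochner_Integration.integrable_bound)
    show "integrable M (\<lambda>\<omega>. 1 + \<bar>X 1 \<omega>\<bar> powr \<alpha> / \<alpha>)"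
      using moment by auto
    show "AE \<omega> in M. norm (X 1 \<omega>) \<le> norm (1 + \<bar>X 1 \<omega>\<bar> powr \<alpha> / \<alpha>)"
      using abs_less_one_plus_powr[OF \<open>1 < \<alpha>\<close>] by (intro AE_I2) (smt (verit) real_norm_def)
  qed (rule X1)
  have int_powr: "integrable M (\<lambda>\<omega>. \<bar>X 1 \<omega> - c\<bar> powr \<alpha>)" for c
  proof (rule Bochner_Integration.integrable_bound)
    show "integrable M (\<lambda>\<omega>. 2 powr (\<alpha> - 1) * (\<bar>X 1 \<omega>\<bar> powr \<alpha> + \<bar>c\<bar> powr \<alpha>))"
      using moment by auto
    show "AE \<omega> in M. norm (\<bar>X 1 \<omega> - c\<bar> powr \<alpha>)
        \<le> norm (2 powr (\<alpha> - 1) * (\<bar>X 1 \<omega>\<bar> powr \<alpha> + \<bar>c\<bar> powr \<alpha>))"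
      using abs_diff_powr_le[OF \<open>1 < \<alpha>\<close>, where m=0] by (intro AE_I2) simp
  qed measurable

  have tail: "exp (real n * (- \<beta> * D + \<beta> powr \<alpha> / \<alpha> * (2 powr (\<alpha> - 1) * (v + D powr \<alpha>)))) \<le> \<epsilon>"
  proof -
    have "\<epsilon> = exp (- ln (1/\<epsilon>))"
      using \<epsilon> by (simp add: ln_div)
    with exponent(3) show ?thesis
      by (metis exp_le_cancel_iff)
  qed
  have "prob {\<omega> \<in> space M. m + D \<le> \<theta> \<omega>}
      \<le> exp (real n * (- \<beta> * D + \<beta> powr \<alpha> / \<alpha> * (2 powr (\<alpha> - 1) * (v + D powr \<alpha>))))"
    using exponent(1,2) root by (intro catoni_upper_tail[OF iid int_X1 int_powr m v])
      (auto intro: \<open>1 < \<alpha>\<close> \<open>mono \<phi>\<close> upper)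
  with tail have above: "prob {\<omega> \<in> space M. m + D \<le> \<theta> \<omega>} \<le> \<epsilon>"
    by linarith

  have "prob {\<omega> \<in> space M. - m + D \<le> - \<theta> \<omega>}
      \<le> exp (real n * (- \<beta> * D + \<beta> powr \<alpha> / \<alpha> * (2 powr (\<alpha> - 1) * (v + D powr \<alpha>))))"
  proof (rule catoni_upper_tail[where X = "\<lambda>i \<omega>. - X i \<omega>" and \<phi> = "\<lambda>x. - \<phi> (- x)"])
    show "iid_sample M (\<lambda>i \<omega>. - X i \<omega>) n"
      by (rule iid_sample_uminus[OF iid n])
    show "integrable M (\<lambda>\<omega>. - X 1 \<omega>)"
      using int_X1 by simp
    have abs_reflect: "\<bar>- x - c\<bar> = \<bar>x - (- c)\<bar>" for x c :: real
      by simp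
    show "integrable M (\<lambda>\<omega>. \<bar>- X 1 \<omega> - c\<bar> powr \<alpha>)" for c
      unfolding abs_reflect by (rule int_powr)
    show "- m = expectation (\<lambda>\<omega>. - X 1 \<omega>)"
      by (simp add: m)
    show "v = expectation (\<lambda>\<omega>. \<bar>- X 1 \<omega> - - m\<bar> powr \<alpha>)"
      unfolding abs_reflect using v by simp
    show "mono (\<lambda>x. - \<phi> (- x))"
      by (intro monoI) (simp add: monoD[OF \<open>mono \<phi>\<close>])
    show "- \<phi> (- x) \<le> ln (1 + x + \<bar>x\<bar> powr \<alpha> / \<alpha>)" for x
      using lower[of "- x"] by simp
    show "AE \<omega> in M. (\<Sum>i=1..n. - \<phi> (- (\<beta> * (- X i \<omega> - - \<theta> \<omega>)))) = 0"
      using root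
    proof eventually_elim
      case (elim \<omega>)
      have "- (\<beta> * (- X i \<omega> - - \<theta> \<omega>)) = \<beta> * (X i \<omega> - \<theta> \<omega>)" for i
        by (simp add: algebra_simps)
      with elim show ?case
        by (simp add: sum_negf)
    qed
  qed (use \<open>1 < \<alpha>\<close> exponent(1,2) in auto)
  with tail have below: "prob {\<omega> \<in> space M. - m + D \<le> - \<theta> \<omega>} \<le> \<epsilon>"
    by linarith

  let ?good = "{\<omega> \<in> space M. \<bar>m - \<theta> \<omega>\<bar> < D}"
  have "1 - prob ?good = prob (space M - ?good)"
    by (subst prob_compl) auto
  also have "space M - ?good
      = {\<omega> \<in> space M. m + D \<le> \<theta> \<omega>} \<union> {\<omega> \<in> space M. - m + D \<le> - \<theta> \<omega>}"
    by auto
  also have "prob \<dots> \<le> prob {\<omega> \<in> space M. m + D \<le> \<theta> \<omega>} + prob {\<omega> \<in> space M. - m + D \<le> - \<theta> \<omega>}"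
    by (rule measure_Un_le) auto
  also have "\<dots> \<le> 2 * \<epsilon>"
    using above below by simp
  finally show ?thesis
    by (simp add: D_def)
qed

theorem theorem2p6:
  fixes \<alpha> v :: real
  assumes "1 < \<alpha>" and "\<alpha> < 2" and "0 < v"
  shows
    "(\<forall>(M :: 'a measure) (X :: nat \<Rightarrow> 'a \<Rightarrow> real) (\<phi> :: real \<Rightarrow> real) (\<epsilon> :: real) (n :: nat)
        (\<theta> :: 'a \<Rightarrow> real) (m :: real).
        iid_sample M X n \<longrightarrow>
        integrable M (\<lambda>\<omega>. \<bar>X 1 \<omega>\<bar> powr \<alpha>) \<longrightarrow>
        m = (\<integral>\<omega>. X 1 \<omega> \<partial>M) \<longrightarrow>
        v = (\<integral>\<omega>. \<bar>X 1 \<omega> - m\<bar> powr \<alpha> \<partial>M) \<longrightarrow>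
        influence_function \<alpha> \<phi> \<longrightarrow>
        admissible \<alpha> v \<epsilon> n \<longrightarrow>
        catoni_estimator M X n \<phi> (scale_parameter \<alpha> v \<epsilon> n) \<theta> \<longrightarrow>
        measure M {\<omega> \<in> space M. \<bar>m - \<theta> \<omega>\<bar> < deviation_bound \<alpha> v \<epsilon> n} \<ge> 1 - 2 * \<epsilon>) \<and>
     (\<lambda>(\<epsilon>, n). deviation_bound \<alpha> v \<epsilon> n)
       \<in> O[principal {(\<epsilon>, n). admissible \<alpha> v \<epsilon> n}](
           \<lambda>(\<epsilon>, n). ln (1/\<epsilon>) powr ((\<alpha> - 1) / \<alpha>) * real n powr (- (\<alpha> - 1) / \<alpha>))"
proof (intro conjI allI impI)
  fix M :: "'a measure" and X :: "nat \<Rightarrow> 'a \<Rightarrow> real" and \<phi> \<epsilon> n \<theta> m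
  assume "iid_sample M X n" "integrable M (\<lambda>\<omega>. \<bar>X 1 \<omega>\<bar> powr \<alpha>)" "m = (\<integral>\<omega>. X 1 \<omega> \<partial>M)"
    "v = (\<integral>\<omega>. \<bar>X 1 \<omega> - m\<bar> powr \<alpha> \<partial>M)" "influence_function \<alpha> \<phi>" "admissible \<alpha> v \<epsilon> n"
    "catoni_estimator M X n \<phi> (scale_parameter \<alpha> v \<epsilon> n) \<theta>"
  then show "1 - 2 * \<epsilon> \<le> measure M {\<omega> \<in> space M. \<bar>m - \<theta> \<omega>\<bar> < deviation_bound \<alpha> v \<epsilon> n}"
    by (rule catoni_deviation[OF \<open>1 < \<alpha>\<close> \<open>0 < v\<close>])
next
  show "(\<lambda>(\<epsilon>, n). deviation_bound \<alpha> v \<epsilon> n)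
       \<in> O[principal {(\<epsilon>, n). admissible \<alpha> v \<epsilon> n}](
           \<lambda>(\<epsilon>, n). ln (1/\<epsilon>) powr ((\<alpha> - 1) / \<alpha>) * real n powr (- (\<alpha> - 1) / \<alpha>))"
  proof (rule bigoI[where c = "(2 * v + 1) / \<alpha> * (2 * \<alpha> / v) powr ((\<alpha> - 1) / \<alpha>)"])
    have "norm (deviation_bound \<alpha> v \<epsilon> n)
      \<le> (2 * v + 1) / \<alpha> * (2 * \<alpha> / v) powr ((\<alpha> - 1) / \<alpha>)
        * norm (ln (1/\<epsilon>) powr ((\<alpha> - 1) / \<alpha>) * real n powr (- (\<alpha> - 1) / \<alpha>))"
      if adm: "admissible \<alpha> v \<epsilon> n" for \<epsilon> n
      using deviation_bound_le[OF \<open>1 < \<alpha>\<close> \<open>0 < v\<close> adm]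
        deviation_bound_exponent(2)[OF \<open>1 < \<alpha>\<close> \<open>0 < v\<close> adm] by (simp add: abs_mult)
    then show "\<forall>\<^sub>F x in principal {(\<epsilon>, n). admissible \<alpha> v \<epsilon> n}.
        norm (case x of (\<epsilon>, n) \<Rightarrow> deviation_bound \<alpha> v \<epsilon> n)
        \<le> (2 * v + 1) / \<alpha> * (2 * \<alpha> / v) powr ((\<alpha> - 1) / \<alpha>)
          * norm (case x of (\<epsilon>, n) \<Rightarrow>
              ln (1/\<epsilon>) powr ((\<alpha> - 1) / \<alpha>) * real n powr (- (\<alpha> - 1) / \<alpha>))"
      by (auto simp only: eventually_principal mem_Collect_eq prod.case)
  qed
qed

end
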